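(* Let $p>1$ be an integer and let $u^{(p)}$ be the infinite word over $\{L,S,M\}$ invariant under the substitution $\varphi_p$ defined by $\varphi_p(L)=L^pS$, $\varphi_p(S)=M$, $\varphi_p(M)=L^{p-1}S$. Then $u^{(p)}$ is $3$-balanced with respect to the letter $L$, $2$-balanced with respect to the letter $S$, and $2$-balanced with respect to the letter $M$, and none of these bounds can be improved (i.e. $u^{(p)}$ is not $2$-balanced with respect to $L$, not $1$-balanced with respect to $S$, and not $1$-balanced with respect to $M$).
   Context: The substitution $\varphi_p$ is extended to a morphism of the free monoid $\{L,S,M\}^*$ and to infinite words; its unique fixed point is $u^{(p)}=\lim_{n\to\infty}\varphi_p^n(L)$. A factor of an infinite word $u$ is a finite word $w$ such that $u=w^{(1)}ww^{(2)}$ for some finite word $w^{(1)}$ and infinite word $w^{(2)}$. For a finite word $w$, $|w|$ is its length and $|w|_a$ the number of occurrences of the letter $a$ in $w$. An infinite word $u$ is $c$-balanced with respect to the letter $a$ if $\left||v|_a-|w|_a\right|\le c$ for all pairs of factors $v,w$ of $u$ with $|v|=|w|$. *)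

theory Defs
  imports Main
begin

datatype letter = L | S | M

fun phi_letter :: "nat \<Rightarrow> letter \<Rightarrow> letter list" where
  "phi_letter p L = replicate p L @ [S]"
| "phi_letter p S = [M]"
| "phi_letter p M = replicate (p - 1) L @ [S]"

definition phi :: "nat \<Rightarrow> letter list \<Rightarrow> letter list" where
  "phi p w = concat (map (phi_letter p) w)"

text \<open>The fixed point u^(p) = lim phi_p^n(L), as an infinite word (nat \<Rightarrow> letter):
  its n-th letter is the n-th letter of phi_p^k(L) for the least k with
  length (phi_p^k(L)) > n (phi_p^k(L) is a prefix of phi_p^(k+1)(L)).\<close>
definition u :: "nat \<Rightarrow> nat \<Rightarrow> letter" where
  "u p n = ((phi p ^^ (LEAST k. n < length ((phi p ^^ k) [L]))) [L]) ! n"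

definition factor :: "letter list \<Rightarrow> (nat \<Rightarrow> letter) \<Rightarrow> bool" where
  "factor w x \<longleftrightarrow> (\<exists>i. w = map x [i..<i + length w])"

definition occ :: "letter list \<Rightarrow> letter \<Rightarrow> nat" where
  "occ w a = length (filter (\<lambda>b. b = a) w)"

definition balanced :: "nat \<Rightarrow> letter \<Rightarrow> (nat \<Rightarrow> letter) \<Rightarrow> bool" where
  "balanced c a x \<longleftrightarrow>
     (\<forall>v w. factor v x \<longrightarrow> factor w x \<longrightarrow> length v = length w \<longrightarrow>
        \<bar>int (occ v a) - int (occ w a)\<bar> \<le> int c)"

end

theory Submission
  imports Defs
begin

text \<open>
  Write the letter at position \<open>n\<close> of the fixed point as the letter at offset \<open>k\<close> in the image of
  the letter at position \<open>i\<close>. Up to a bounded error \<open>n\<close> is an affine function of \<open>i\<close> and of the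
  numbers of \<open>S\<close> and \<open>M\<close> before \<open>i\<close>, and the numbers of \<open>S\<close> and \<open>M\<close> before \<open>n\<close> are such functions too.
  Comparing two factors means evaluating the signed sum \<open>f j + f k - f i - f l\<close> of these counting
  functions at four positions with \<open>j + k = i + l\<close>. Desubstituting all four positions at once need not
  preserve this equality, so one follows quadruples with \<open>j + k - i - l\<close> bounded by a constant: a
  finite system of linear inequalities between the signed sums is preserved, with separate systems
  for \<open>p = 2\<close> and \<open>p \<ge> 3\<close>. If the bound is exceeded, the larger positions are lowered until it is met.
  Optimality is shown by explicit factors.
\<close>

section \<open>Letter counts in images\<close>

lemma phi_Nil [simp]: "phi p [] = []"
  and phi_Cons: "phi p (a # w) = phi_letter p a @ phi p w"
  and phi_append: "phi p (v @ w) = phi p v @ phi p w"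
  by (simp_all add: phi_def)

lemma occ_simps [simp]:
  "occ [] a = 0" "occ (b # w) a = (if b = a then 1 else 0) + occ w a"
  "occ (v @ w) a = occ v a + occ w a" "occ (replicate n b) a = (if b = a then n else 0)"
  by (auto simp: occ_def)

lemma occ_phi_letter:
  assumes "p > 0"
  shows "occ (phi_letter p b) S = (if b = S then 0 else 1)"
    and "occ (phi_letter p b) M = (if b = S then 1 else 0)"
  using assms by (cases b; simp)+

lemma occ_phi_S: "p > 0 \<Longrightarrow> occ (phi p w) S + occ w S = length w"
  by (induction w) (auto simp: phi_Cons occ_phi_letter)

lemma occ_phi_M: "p > 0 \<Longrightarrow> occ (phi p w) M = occ w S"
  by (induction w) (auto simp: phi_Cons occ_phi_letter)

lemma length_phi: "p > 0 \<Longrightarrow> length (phi p w) + p * occ w S + occ w M = (p + 1) * length w"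
proof (induction w)
  case (Cons a w)
  then show ?case by (cases a) (auto simp: phi_Cons algebra_simps)
qed simp

lemma letter_count: "occ w L + occ w S + occ w M = length w"
proof (induction w)
  case (Cons a w)
  then show ?case by (cases a) auto
qed simp

lemma length_le_phi: "p > 0 \<Longrightarrow> length (phi p w) \<ge> length w"
proof (induction w)
  case (Cons a w)
  then show ?case by (cases a) (auto simp: phi_Cons)
qed simp

section \<open>The arithmetic invariant\<close>

text \<open>
  The unprimed variables describe a quadruple \<open>(j, k, i, l)\<close> of positions, the primed ones the quadruple
  of positions obtained by desubstitution: \<open>n\<close>, \<open>x\<close>, \<open>z\<close> are the signed sums of the positions and of the
  counts of \<open>S\<close> and \<open>M\<close>; \<open>s\<close> is the number of \<open>S\<close> at \<open>j\<close>, \<open>k\<close> and \<open>t\<close> that at \<open>i\<close>, \<open>l\<close>.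
\<close>

definition desubst_rel ::
  "int \<Rightarrow> int \<Rightarrow> int \<Rightarrow> int \<Rightarrow> int \<Rightarrow> int \<Rightarrow> int \<Rightarrow> int \<Rightarrow> int \<Rightarrow> int \<Rightarrow> int \<Rightarrow> bool" where
  "desubst_rel p n x z s t n' x' z' s' t' \<longleftrightarrow>
     0 \<le> s \<and> 0 \<le> t \<and> 0 \<le> s' \<and> 0 \<le> t' \<and> s + s' \<le> 2 \<and> t + t' \<le> 2 \<and>
     x = n' - x' \<and> z = x' + s' - t' \<and>
     n \<le> p * (x + 2 - t - s') + n' - z' - 2 + s + s' \<and>
     n \<ge> p * (x - 2 + s + t') + n' - z' + 2 - t - t'"

text \<open>
  The inequalities below were found by computer search; exchanging \<open>(j, k)\<close> with \<open>(i, l)\<close> negates \<open>n\<close>,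
  \<open>x\<close>, \<open>z\<close> and swaps \<open>s\<close> with \<open>t\<close>, which gives the other half of the invariant.
\<close>

definition half_inv2 :: "int \<Rightarrow> int \<Rightarrow> int \<Rightarrow> int \<Rightarrow> int \<Rightarrow> bool" where
  "half_inv2 n x z s t \<longleftrightarrow>
     x - t \<ge> -5 \<and> z \<ge> -3 \<and>
     (x - t = -5 \<longrightarrow> n - s \<le> -8) \<and>
     (x - t = -4 \<longrightarrow> n - s \<le> t - 7 \<and> n - s \<le> z - 5) \<and>
     (x - t = -3 \<longrightarrow> n - s \<le> t - 4 \<and> n - s \<le> z - 3) \<and>
     (x - t = -2 \<longrightarrow> n - s \<le> t - 1 \<and> n - s \<le> z) \<and>
     (z = -2 \<and> x - t = -2 \<longrightarrow> n - s \<le> -3) \<and>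
     (z = -2 \<and> x - t = -1 \<longrightarrow> n - s \<le> 0) \<and>
     (z \<le> -2 \<longrightarrow> x < 2) \<and>
     (z = -3 \<longrightarrow> x \<le> -1 \<and> n - s \<le> 2 * (x - t) - 1)"

definition half_inv3 :: "int \<Rightarrow> int \<Rightarrow> int \<Rightarrow> int \<Rightarrow> int \<Rightarrow> bool" where
  "half_inv3 n x z s t \<longleftrightarrow>
     x - t \<ge> -3 \<and> z \<ge> -3 \<and>
     (x - t = -3 \<longrightarrow> n - s \<le> t - 5 \<and> n - s \<le> z - 4) \<and>
     (x - t = -2 \<longrightarrow> n - s \<le> t - 1) \<and>
     (z \<le> -2 \<and> x - t = -2 \<longrightarrow> n - s \<le> -3) \<and>
     (z = -3 \<longrightarrow> n - s \<le> -6) \<and>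
     (z \<le> -2 \<longrightarrow> x < 2)"

text \<open>Finitely many linear cases, since all sums lie between -6 and 6. Both halves at the
  primed quadruple are needed for one half at the unprimed one; the other half then follows by the
  exchange symmetry.\<close>

lemma half_inv2_step:
  assumes "half_inv2 n' x' z' s' t'" "half_inv2 (-n') (-x') (-z') t' s'"
    "desubst_rel 2 n x z s t n' x' z' s' t'" "-6 \<le> n'" "n' \<le> 6" "-6 \<le> n" "n \<le> 6"
  shows "half_inv2 n x z s t"
  using assms unfolding half_inv2_def desubst_rel_def
  by (smt (z3))

text \<open>Describes lowering the positions \<open>j\<close>, \<open>k\<close> of the primed
  quadruple. Counts of a letter and of its complement are both monotone. The last clause treats the
  case where only \<open>S\<close> is passed: as \<open>SS\<close> never occurs, a position then
  moves by at most one.\<close>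

definition truncates :: "int \<Rightarrow> int \<Rightarrow> int \<Rightarrow> int \<Rightarrow> int \<Rightarrow> int \<Rightarrow> int \<Rightarrow> int \<Rightarrow> bool" where
  "truncates n x z s n' x' z' s' \<longleftrightarrow>
     n < n' \<and> 0 \<le> s \<and> s \<le> 2 \<and> x \<le> x' \<and> n - x \<le> n' - x' \<and> z \<le> z' \<and> n - z \<le> n' - z' \<and>
     (n - x = n' - x' \<longrightarrow> s' + n' = s + n)"

text \<open>Used when the desubstituted sum \<open>n'\<close> exceeds 6: the invariant is then known
  only for the lowered quadruple, of sum exactly 6. Lowering treats the two pairs differently, so
  both halves are proved together.\<close>

lemma half_inv2_truncate:
  assumes "half_inv2 6 x'' z'' s'' t'" "half_inv2 (-6) (-x'') (-z'') t' s''"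
    "truncates 6 x'' z'' s'' n' x' z' s'"
    "desubst_rel 2 n x z s t n' x' z' s' t'" "-6 \<le> n" "n \<le> 6"
  shows "half_inv2 n x z s t \<and> half_inv2 (-n) (-x) (-z) t s \<and> n > 0"
  using assms unfolding half_inv2_def desubst_rel_def truncates_def
  by (smt (z3))

text \<open>For \<open>n = 0\<close> the sum \<open>n'\<close> will be the signed count of the
  letters other than \<open>L\<close>, so this is the source of the constant 3.\<close>

lemma half_inv2_parent_le:
  assumes "half_inv2 n' x' z' s' t'" "half_inv2 (-n') (-x') (-z') t' s'"
    "half_inv2 0 x z s t" "half_inv2 0 (-x) (-z) t s"
    "desubst_rel 2 0 x z s t n' x' z' s' t'" "-6 \<le> n'" "n' \<le> 6"
  shows "n' \<le> 3"
  using assms unfolding half_inv2_def desubst_rel_def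
  by (smt (z3))

text \<open>At \<open>n = 0\<close>, \<open>x - t = -3\<close> forces \<open>s = t = 2\<close>,
  lower values of \<open>x - t\<close> are impossible, and \<open>z = -3\<close> would need
  \<open>s \<ge> 3\<close>. This is the source of the constant 2 for \<open>S\<close> and
  \<open>M\<close>.\<close>

lemma half_inv2_zero:
  assumes "half_inv2 0 x z s t" "0 \<le> s" "0 \<le> t" "s \<le> 2" "t \<le> 2"
  shows "x \<ge> -2" "z \<ge> -2"
  using assms unfolding half_inv2_def
  by (smt (z3))+

text \<open>The product with the unknown \<open>p\<close> is replaced by linear bounds, so that linear arithmetic applies.\<close>

lemma desubst_rel_linear:
  assumes "desubst_rel p n x z s t n' x' z' s' t'" "p \<ge> 3"
  obtains a b where
     "0 \<le> s \<and> 0 \<le> t \<and> 0 \<le> s' \<and> 0 \<le> t' \<and> s + s' \<le> 2 \<and> t + t' \<le> 2 \<and>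
     x = n' - x' \<and> z = x' + s' - t' \<and>
     n \<le> a + n' - z' - 2 + s + s' \<and>
     n \<ge> b + n' - z' + 2 - t - t'"
    "x + 2 - t - s' \<le> 0 \<Longrightarrow> a \<le> 3 * (x + 2 - t - s')"
    "x - 2 + s + t' \<ge> 0 \<Longrightarrow> b \<ge> 3 * (x - 2 + s + t')"
  using that[OF assms(1)[unfolded desubst_rel_def]] assms(2)
  by (meson mult_right_mono mult_right_mono_neg)

lemma half_inv3_step:
  assumes "half_inv3 n' x' z' s' t'" "half_inv3 (-n') (-x') (-z') t' s'"
    "desubst_rel p n x z s t n' x' z' s' t'" "-4 \<le> n'" "n' \<le> 4" "-4 \<le> n" "n \<le> 4" "p \<ge> 3"
  shows "half_inv3 n x z s t"
  using assms(1,2,4-7) unfolding half_inv3_def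
  by (rule_tac desubst_rel_linear[OF assms(3) assms(8)]) (smt (z3))

lemma half_inv3_truncate:
  assumes "half_inv3 4 x'' z'' s'' t'" "half_inv3 (-4) (-x'') (-z'') t' s''"
    "truncates 4 x'' z'' s'' n' x' z' s'"
    "desubst_rel p n x z s t n' x' z' s' t'" "-4 \<le> n" "n \<le> 4" "p \<ge> 3"
  shows "half_inv3 n x z s t \<and> half_inv3 (-n) (-x) (-z) t s \<and> n > 0"
  using assms(1-3,5,6) unfolding half_inv3_def truncates_def
  by (rule_tac desubst_rel_linear[OF assms(4) assms(7)]) (smt (z3))

lemma half_inv3_parent_le:
  assumes "half_inv3 n' x' z' s' t'" "half_inv3 (-n') (-x') (-z') t' s'"
    "half_inv3 0 x z s t" "half_inv3 0 (-x) (-z) t s"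
    "desubst_rel p 0 x z s t n' x' z' s' t'" "-4 \<le> n'" "n' \<le> 4" "p \<ge> 3"
  shows "n' \<le> 3"
  using assms(1-4,6-7) unfolding half_inv3_def
  by (rule_tac desubst_rel_linear[OF assms(5) assms(8)]) (smt (z3))

lemma half_inv3_zero:
  assumes "half_inv3 0 x z s t" "0 \<le> s" "0 \<le> t" "s \<le> 2" "t \<le> 2"
  shows "x \<ge> -2" "z \<ge> -2"
  using assms unfolding half_inv3_def
  by (smt (z3))+

section \<open>The invariant for all \<open>p\<close>, with its exchange symmetry\<close>

definition invariant_bound :: "int \<Rightarrow> int" where "invariant_bound p = (if p = 2 then 6 else 4)"

definition invariant :: "int \<Rightarrow> int \<Rightarrow> int \<Rightarrow> int \<Rightarrow> int \<Rightarrow> int \<Rightarrow> bool" where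
  "invariant p n x z s t \<longleftrightarrow>
     (if p = 2 then half_inv2 n x z s t \<and> half_inv2 (-n) (-x) (-z) t s
      else half_inv3 n x z s t \<and> half_inv3 (-n) (-x) (-z) t s)"

lemma invariant_0: "invariant p 0 0 0 0 0"
  by (simp add: invariant_def half_inv2_def half_inv3_def)

lemma invariant_swap: "invariant p n x z s t \<Longrightarrow> invariant p (-n) (-x) (-z) t s"
  by (simp add: invariant_def split: if_splits)

lemma desubst_rel_swap:
  "desubst_rel p n x z s t n' x' z' s' t' \<Longrightarrow>
   desubst_rel p (-n) (-x) (-z) t s (-n') (-x') (-z') t' s'"
  unfolding desubst_rel_def by (auto simp: algebra_simps)

lemma invariant_step:
  assumes "invariant p n' x' z' s' t'" "\<bar>n'\<bar> \<le> invariant_bound p" "\<bar>n\<bar> \<le> invariant_bound p" "p \<ge> 2"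
    "desubst_rel p n x z s t n' x' z' s' t'"
  shows "invariant p n x z s t"
proof (cases "p = 2")
  case True
  then show ?thesis
    using assms half_inv2_step[of n' x' z' s' t' n x z s t] desubst_rel_swap[OF assms(5)]
      half_inv2_step[of "-n'" "-x'" "-z'" t' s' "-n" "-x" "-z" t s]
    by (simp add: invariant_def invariant_bound_def abs_le_iff)
next
  case False
  then show ?thesis
    using assms half_inv3_step[of n' x' z' s' t' p n x z s t] desubst_rel_swap[OF assms(5)]
      half_inv3_step[of "-n'" "-x'" "-z'" t' s' p "-n" "-x" "-z" t s]
    by (simp add: invariant_def invariant_bound_def abs_le_iff)
qed

lemma invariant_truncate:
  assumes "invariant p (invariant_bound p) x'' z'' s'' t'" "truncates (invariant_bound p) x'' z'' s'' n' x' z' s'"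
    "desubst_rel p n x z s t n' x' z' s' t'" "\<bar>n\<bar> \<le> invariant_bound p" "p \<ge> 2"
  shows "invariant p n x z s t \<and> n > 0"
proof (cases "p = 2")
  case True
  then show ?thesis
    using assms half_inv2_truncate[of x'' z'' s'' t' n' x' z' s' n x z s t]
    by (simp add: invariant_def invariant_bound_def abs_le_iff)
next
  case False
  then show ?thesis
    using assms half_inv3_truncate[of x'' z'' s'' t' n' x' z' s' p n x z s t]
    by (simp add: invariant_def invariant_bound_def abs_le_iff)
qed

lemma invariant_parent_le:
  assumes "invariant p n' x' z' s' t'" "invariant p 0 x z s t" "desubst_rel p 0 x z s t n' x' z' s' t'"
    "\<bar>n'\<bar> \<le> invariant_bound p" "p \<ge> 2"
  shows "n' \<le> 3"
proof (cases "p = 2")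
  case True
  then show ?thesis
    using assms half_inv2_parent_le[of n' x' z' s' t' x z s t]
    by (simp add: invariant_def invariant_bound_def abs_le_iff)
next
  case False
  then show ?thesis
    using assms half_inv3_parent_le[of n' x' z' s' t' x z s t p]
    by (simp add: invariant_def invariant_bound_def abs_le_iff)
qed

lemma invariant_zero:
  assumes "invariant p 0 x z s t" "0 \<le> s" "0 \<le> t" "s \<le> 2" "t \<le> 2"
  shows "\<bar>x\<bar> \<le> 2" "\<bar>z\<bar> \<le> 2"
  using assms half_inv2_zero[of x z s t] half_inv2_zero[of "-x" "-z" t s]
    half_inv3_zero[of x z s t] half_inv3_zero[of "-x" "-z" t s]
  by (auto simp: invariant_def abs_le_iff split: if_splits)

section \<open>The fixed point and its desubstitution\<close>

locale phi_word =
  fixes p :: nat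
  assumes p_gt_1: "p > 1"
begin

lemma p_pos: "p > 0"
  using p_gt_1 by simp

abbreviation it :: "nat \<Rightarrow> letter list" where "it k \<equiv> (phi p ^^ k) [L]"
abbreviation w :: "nat \<Rightarrow> letter" where "w \<equiv> u p"

text \<open>As \<open>p \<ge> 2\<close>, the image of \<open>L\<close> starts with
  \<open>LL\<close>; iterating the morphism keeps this square prefix, which yields both the limit
  and recurrence.\<close>

lemma it_Suc: "\<exists>v. it (Suc k) = it k @ it k @ v"
proof (induction k)
  case 0
  obtain m where "p = Suc (Suc m)" using p_gt_1 by (metis Suc_lessE less_imp_Suc_add One_nat_def)
  then show ?case by (simp add: phi_def)
next
  case (Suc k)
  then obtain v where "it (Suc k) = it k @ it k @ v" by blast
  then have "phi p (it (Suc k)) = phi p (it k) @ phi p (it k) @ phi p v"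
    by (simp only: phi_append)
  then show ?case by auto
qed

lemma it_prefix: "k \<le> l \<Longrightarrow> \<exists>v. it l = it k @ v"
proof (induction l rule: dec_induct)
  case (step l)
  then show ?case using it_Suc[of l] by (metis append.assoc)
qed simp

lemma length_it: "length (it k) > k"
proof (induction k)
  case (Suc k)
  then show ?case using it_Suc[of k] by fastforce
qed simp

lemma w_it:
  assumes "n < length (it k)"
  shows "w n = it k ! n"
proof -
  define m where "m = (LEAST k. n < length (it k))"
  have "n < length (it m)" "m \<le> k"
    unfolding m_def using assms by (auto intro: LeastI Least_le)
  then show ?thesis
    unfolding u_def m_def[symmetric] using it_prefix[of m k] by (auto simp: nth_append)
qed

definition pre :: "nat \<Rightarrow> letter list" where "pre n = map w [0..<n]"

lemma pre_0 [simp]: "pre 0 = []" and length_pre [simp]: "length (pre n) = n"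
  and pre_Suc: "pre (Suc n) = pre n @ [w n]"
  and pre_nth: "i < n \<Longrightarrow> pre n ! i = w i"
  by (simp_all add: pre_def)

lemma pre_it: "n \<le> length (it k) \<Longrightarrow> pre n = take n (it k)"
  by (rule nth_equalityI) (auto simp: pre_nth w_it)

definition F :: "nat \<Rightarrow> nat" where "F n = length (phi p (pre n))"

text \<open>The fixed point property on prefixes: a prefix of an iterate is mapped to a prefix of
  the next iterate.\<close>

lemma pre_F: "pre (F n) = phi p (pre n)"
proof -
  have "it n = pre n @ drop n (it n)"
    using pre_it[of n n] length_it[of n] by simp
  then have e: "it (Suc n) = phi p (pre n) @ phi p (drop n (it n))"
    by (metis phi_append funpow.simps(2) comp_apply)
  then have "F n \<le> length (it (Suc n))" by (simp add: F_def)
  then show ?thesis using pre_it[of "F n" "Suc n"] e by (simp add: F_def)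
qed

lemma F_0 [simp]: "F 0 = 0" and F_Suc: "F (Suc n) = F n + length (phi_letter p (w n))"
  by (simp_all add: F_def pre_Suc phi_append phi_Cons)

lemma w_F: "k < length (phi_letter p (w n)) \<Longrightarrow> w (F n + k) = phi_letter p (w n) ! k"
proof -
  assume k: "k < length (phi_letter p (w n))"
  have "pre (F (Suc n)) = pre (F n) @ phi_letter p (w n)"
    by (simp add: pre_F pre_Suc phi_append phi_Cons)
  moreover have "F n + k < F (Suc n)" using k by (simp add: F_Suc)
  ultimately show ?thesis using k by (metis length_pre nth_append_length_plus pre_nth)
qed

lemma pre_F_plus:
  "k \<le> length (phi_letter p (w n)) \<Longrightarrow> pre (F n + k) = pre (F n) @ take k (phi_letter p (w n))"
proof (rule nth_equalityI)
  fix i assume k: "k \<le> length (phi_letter p (w n))" and i: "i < length (pre (F n + k))"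
  show "pre (F n + k) ! i = (pre (F n) @ take k (phi_letter p (w n))) ! i"
  proof (cases "i < F n")
    case False
    then obtain d where "i = F n + d" using le_Suc_ex[of "F n" i] by auto
    then show ?thesis using i k by (auto simp: pre_nth w_F nth_append)
  qed (use i in \<open>auto simp: pre_nth nth_append\<close>)
qed simp

lemma F_ge: "F n \<ge> n"
  using length_le_phi[OF p_pos, of "pre n"] by (simp add: F_def)

text \<open>Strict because the word starts with \<open>L\<close>, whose image is longer than one
  letter. Hence desubstitution strictly lowers positive positions.\<close>

lemma F_gt: "n > 0 \<Longrightarrow> F n > n"
proof (induction n)
  case (Suc n)
  have "w 0 = L" using w_it[of 0 0] by simp
  then show ?case using Suc p_gt_1
    by (cases "n = 0"; cases "w n") (auto simp: F_Suc)
qed simp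

lemma desubst: obtains i k where "n = F i + k" "k < length (phi_letter p (w i))"
proof -
  define i where "i = (LEAST i. n < F (Suc i))"
  have ex: "n < F (Suc n)" using F_gt[of "Suc n"] by simp
  have 1: "n < F (Suc i)" unfolding i_def by (rule LeastI[of "\<lambda>i. n < F (Suc i)", OF ex])
  have 2: "F i \<le> n"
  proof (cases i)
    case (Suc j)
    then show ?thesis using not_less_Least[of j "\<lambda>i. n < F (Suc i)"] i_def by auto
  qed simp
  show thesis using that[of i "n - F i"] 1 2 by (simp add: F_Suc)
qed

lemma recurrent: "\<exists>a>0. \<forall>i<n. w (a + i) = w i"
proof -
  obtain v where v: "it (Suc n) = it n @ it n @ v" using it_Suc by blast
  let ?a = "length (it n)"
  have "w (?a + i) = w i" if "i < n" for i
  proof -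
    have "i < ?a" using that length_it[of n] by simp
    then show ?thesis using v w_it[of "?a + i" "Suc n"] w_it[of i n] by (simp add: nth_append)
  qed
  moreover have "?a > 0" using length_it[of n] by linarith
  ultimately show ?thesis by blast
qed

section \<open>Counting functions\<close>

text \<open>
  \<open>E\<close> includes position \<open>i\<close> itself, while \<open>C\<close> and \<open>D\<close> do not: this makes the error term \<open>k\<close> of
  desubstitution equal to \<open>p\<close> exactly when the letter at \<open>n\<close> is \<open>S\<close>, whether it comes from \<open>L\<close> or \<open>M\<close>.
\<close>

definition B :: "nat \<Rightarrow> int" where "B i = (if w i = S then 1 else 0)"
definition C :: "nat \<Rightarrow> int" where "C i = int (occ (pre i) S)"
definition D :: "nat \<Rightarrow> int" where "D i = int (occ (pre i) M)"
definition E :: "nat \<Rightarrow> int" where "E i = int (occ (pre (Suc i)) M)"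

lemma B_cases: "B i = 0 \<or> B i = 1" by (simp add: B_def)
lemma C_Suc: "C (Suc i) = C i + B i" by (simp add: B_def C_def pre_Suc)
lemma E_Suc: "E i \<le> E (Suc i) \<and> E (Suc i) \<le> E i + 1"
  by (simp add: E_def pre_Suc)

lemma desubst_int:
  obtains i k where
    "int n = int i + int p * C n - E i + k" "0 \<le> k" "k \<le> int p" "k = int p \<longleftrightarrow> B n = 1"
    "B i = 1 \<longrightarrow> k = 0" "C n = int i - C i" "E n = C i + B i"
    "D n = C i" "i \<le> n" "n > 0 \<longrightarrow> i < n"
proof -
  obtain i k where n: "n = F i + k" and k: "k < length (phi_letter p (w i))"
    by (rule desubst)
  \<comment> \<open>The image of \<open>M\<close> is that of \<open>L\<close> without its first
    letter. Shifting the offset by one aligns the two, and \<open>E i\<close> in place of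
    \<open>D i\<close> absorbs the shift.\<close>
  define \<kappa> where "\<kappa> = int k + (if w i = M then 1 else 0)"
  have CF: "C (F i) = int i - C i"
    using occ_phi_S[OF p_pos, of "pre i"] by (simp add: C_def pre_F)
  have DF: "D (F i) = C i"
    using occ_phi_M[OF p_pos, of "pre i"] by (simp add: C_def D_def pre_F)
  \<comment> \<open>\<open>S\<close> and \<open>M\<close> occur in an image only as its last letter,
    so a proper prefix contains neither.\<close>
  have nS: "occ (take k (phi_letter p (w i))) S = 0" using k by (cases "w i") auto
  have nM: "occ (take k (phi_letter p (w i))) M = 0" using k by (cases "w i") auto
  have Cn: "C n = int i - C i"
    using k nS CF by (simp add: C_def n pre_F_plus)
  have Dn: "D n = C i"
    using k nM DF by (simp add: D_def n pre_F_plus)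
  have wn: "w n = phi_letter p (w i) ! k" using w_F[OF k] n by simp
  have En: "E n = C i + B i"
    using Dn wn k p_gt_1 by (cases "w i") (auto simp: E_def D_def pre_Suc B_def nth_append)
  have "int (F i) + int p * C i + D i = (int p + 1) * int i"
    using length_phi[OF p_pos, of "pre i"] unfolding F_def C_def D_def length_pre
    by (metis (no_types, lifting) of_nat_add of_nat_mult of_nat_1)
  moreover have "E i = D i + (if w i = M then 1 else 0)"
    by (simp add: E_def D_def pre_Suc)
  ultimately have eq: "int n = int i + int p * C n - E i + \<kappa>"
    unfolding Cn \<kappa>_def by (simp add: n algebra_simps)
  have kp: "\<kappa> \<le> int p" "\<kappa> = int p \<longleftrightarrow> B n = 1" "B i = 1 \<longrightarrow> \<kappa> = 0"
    using k wn p_gt_1 by (cases "w i"; auto simp: \<kappa>_def B_def nth_append split: if_splits)+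
  have "i \<le> n" using F_ge[of i] n by simp
  moreover have "i < n" if "n > 0"
    using F_gt[of i] n that by (cases "i = 0") auto
  ultimately show thesis using that[OF eq _ kp Cn En Dn] by (auto simp: \<kappa>_def)
qed

text \<open>An \<open>S\<close> ends the image containing it, and every image starts with
  \<open>L\<close> or \<open>M\<close>.\<close>

lemma no_SS: "B i = 1 \<Longrightarrow> B (Suc i) = 0"
proof -
  assume B: "B i = 1"
  obtain j k where n: "i = F j + k" and k: "k < length (phi_letter p (w j))"
    by (rule desubst)
  have "w i = phi_letter p (w j) ! k" using w_F[OF k] n by simp
  then have "Suc k = length (phi_letter p (w j))"
    using B k by (cases "w j") (auto simp: B_def nth_append split: if_splits)
  then have "Suc i = F (Suc j) + 0" using n by (simp add: F_Suc)
  moreover have "0 < length (phi_letter p (w (Suc j)))" by (cases "w (Suc j)") auto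
  ultimately have "w (Suc i) = phi_letter p (w (Suc j)) ! 0" using w_F by metis
  then show "B (Suc i) = 0" using p_gt_1
    by (cases "w (Suc j)") (auto simp: B_def nth_append)
qed

section \<open>Signed sums over quadruples of positions\<close>

abbreviation Q :: "(nat \<Rightarrow> int) \<Rightarrow> nat \<Rightarrow> nat \<Rightarrow> nat \<Rightarrow> nat \<Rightarrow> int" where
  "Q f j k i l \<equiv> f j + f k - f i - f l"

lemma desubst_quadruple:
  obtains j' k' i' l' where
    "desubst_rel (int p) (Q int j k i l) (Q C j k i l) (Q E j k i l) (B j + B k) (B i + B l)
      (Q int j' k' i' l') (Q C j' k' i' l') (Q E j' k' i' l') (B j' + B k') (B i' + B l')"
    "Q C j k i l + Q D j k i l = Q int j' k' i' l'"
    "j' + k' + i' + l' < j + k + i + l \<or> j + k + i + l = 0"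
proof -
  \<comment> \<open>The case distinction on the offset is encoded as bounds linear in the indicators
    \<open>B\<close>, so that the four positions can be added up.\<close>
  have ex: "\<exists>i \<kappa>. int n = int i + int p * C n - E i + \<kappa> \<and> \<kappa> \<ge> int p * B n \<and>
      \<kappa> \<le> (int p - 1) * (1 - B i) + B n \<and> B n + B i \<le> 1 \<and> C n = int i - C i \<and> E n = C i + B i \<and>
      C n + D n = int i \<and> i \<le> n \<and> (n > 0 \<longrightarrow> i < n)" for n
  proof -
    obtain i \<kappa> where h: "int n = int i + int p * C n - E i + \<kappa>" "0 \<le> \<kappa>" "\<kappa> \<le> int p"
      "\<kappa> = int p \<longleftrightarrow> B n = 1" "B i = 1 \<longrightarrow> \<kappa> = 0" "C n = int i - C i" "E n = C i + B i"
      "D n = C i" "i \<le> n" "n > 0 \<longrightarrow> i < n"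
      by (rule desubst_int[of n])
    have "\<kappa> \<ge> int p * B n \<and> \<kappa> \<le> (int p - 1) * (1 - B i) + B n \<and> B n + B i \<le> 1"
      using h(2-5) B_cases[of n] B_cases[of i] p_gt_1 by auto
    then show ?thesis using h by (intro exI[of _ i] exI[of _ \<kappa>]) auto
  qed
  obtain j' \<kappa>j where j: "int j = int j' + int p * C j - E j' + \<kappa>j" "\<kappa>j \<ge> int p * B j"
      "\<kappa>j \<le> (int p - 1) * (1 - B j') + B j" "B j + B j' \<le> 1" "C j = int j' - C j'" "E j = C j' + B j'"
      "C j + D j = int j'" "j' \<le> j" "j > 0 \<longrightarrow> j' < j" using ex[of j] by blast
  obtain k' \<kappa>k where k: "int k = int k' + int p * C k - E k' + \<kappa>k" "\<kappa>k \<ge> int p * B k"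
      "\<kappa>k \<le> (int p - 1) * (1 - B k') + B k" "B k + B k' \<le> 1" "C k = int k' - C k'" "E k = C k' + B k'"
      "C k + D k = int k'" "k' \<le> k" "k > 0 \<longrightarrow> k' < k" using ex[of k] by blast
  obtain i' \<kappa>i where i: "int i = int i' + int p * C i - E i' + \<kappa>i" "\<kappa>i \<ge> int p * B i"
      "\<kappa>i \<le> (int p - 1) * (1 - B i') + B i" "B i + B i' \<le> 1" "C i = int i' - C i'" "E i = C i' + B i'"
      "C i + D i = int i'" "i' \<le> i" "i > 0 \<longrightarrow> i' < i" using ex[of i] by blast
  obtain l' \<kappa>l where l: "int l = int l' + int p * C l - E l' + \<kappa>l" "\<kappa>l \<ge> int p * B l"
      "\<kappa>l \<le> (int p - 1) * (1 - B l') + B l" "B l + B l' \<le> 1" "C l = int l' - C l'" "E l = C l' + B l'"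
      "C l + D l = int l'" "l' \<le> l" "l > 0 \<longrightarrow> l' < l" using ex[of l] by blast
  have n: "Q int j k i l = int p * Q C j k i l + Q int j' k' i' l' - Q E j' k' i' l' + \<kappa>j + \<kappa>k - \<kappa>i - \<kappa>l"
    using j(1) k(1) i(1) l(1) by (simp add: algebra_simps)
  have up: "Q int j k i l \<le> int p * (Q C j k i l + 2 - (B i + B l) - (B j' + B k')) + Q int j' k' i' l'
      - Q E j' k' i' l' - 2 + (B j + B k) + (B j' + B k')"
    unfolding n using j(3) k(3) i(2) l(2) by (simp add: algebra_simps)
  have lo: "Q int j k i l \<ge> int p * (Q C j k i l - 2 + (B j + B k) + (B i' + B l')) + Q int j' k' i' l'
      - Q E j' k' i' l' + 2 - (B i + B l) - (B i' + B l')"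
    unfolding n using j(2) k(2) i(3) l(3) by (simp add: algebra_simps)
  have B0: "B n \<ge> 0" for n by (simp add: B_def)
  have "desubst_rel (int p) (Q int j k i l) (Q C j k i l) (Q E j k i l) (B j + B k) (B i + B l)
      (Q int j' k' i' l') (Q C j' k' i' l') (Q E j' k' i' l') (B j' + B k') (B i' + B l')"
    unfolding desubst_rel_def
    using up lo j(4-6) k(4-6) i(4-6) l(4-6) B0 by (intro conjI) (simp_all add: add_mono)
  moreover have "Q C j k i l + Q D j k i l = Q int j' k' i' l'"
    using j(7) k(7) i(7) l(7) by simp
  moreover have "j' + k' + i' + l' < j + k + i + l \<or> j + k + i + l = 0"
    using j(8,9) k(8,9) i(8,9) l(8,9) by linarith
  ultimately show thesis by (rule that)
qed

text \<open>For the last claim: the hypothesis says that only \<open>S\<close> stands from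
  \<open>a\<close> up to \<open>b\<close>, and \<open>no_SS\<close> leaves \<open>b = a\<close> or
  \<open>b = Suc a\<close>.\<close>

lemma truncate_index:
  assumes "a \<le> b"
  shows "C a \<le> C b" "int a - C a \<le> int b - C b" "E a \<le> E b" "int a - E a \<le> int b - E b"
    "int a - C a = int b - C b \<Longrightarrow> B b + int b = B a + int a"
proof -
  have m: "C a \<le> C b \<and> int a - C a \<le> int b - C b \<and> E a \<le> E b \<and> int a - E a \<le> int b - E b"
    if "a \<le> b" for a b
    using that
  proof (induction b rule: dec_induct)
    case (step b)
    then show ?case using E_Suc[of b] B_cases[of b] by (auto simp: C_Suc)
  qed simp
  then show "C a \<le> C b" "int a - C a \<le> int b - C b" "E a \<le> E b" "int a - E a \<le> int b - E b"
    using assms by blast+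
  assume eq: "int a - C a = int b - C b"
  consider "b = a" | "b = Suc a" | "Suc (Suc a) \<le> b" using assms by linarith
  then show "B b + int b = B a + int a"
  proof cases
    case 2
    then show ?thesis using eq no_SS[of a] by (simp add: C_Suc)
  next
    case 3
    then show ?thesis
      using m[OF 3] eq no_SS[of a] B_cases[of a] B_cases[of "Suc a"] by (auto simp: C_Suc)
  qed simp
qed

lemma truncate_quadruple:
  assumes "Q int j k i l > N" "N \<ge> 0"
  obtains j' k' where "j' \<le> j" "k' \<le> k" "Q int j' k' i l = N"
    "truncates N (Q C j' k' i l) (Q E j' k' i l) (B j' + B k')
      (Q int j k i l) (Q C j k i l) (Q E j k i l) (B j + B k)"
proof -
  define d where "d = nat (Q int j k i l - N)"
  \<comment> \<open>Lower \<open>j\<close> first, to 0 if necessary, and take the rest from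
    \<open>k\<close>; \<open>N \<ge> 0\<close> gives \<open>d \<le> j + k\<close>, so this
    suffices.\<close>
  define j' where "j' = j - min j d"
  define k' where "k' = k - (d - min j d)"
  have le: "j' \<le> j" "k' \<le> k" by (simp_all add: j'_def k'_def)
  have N: "Q int j' k' i l = N" using assms by (auto simp: j'_def k'_def d_def min_def)
  have B: "0 \<le> B n \<and> B n \<le> 1" for n by (simp add: B_def)
  have "truncates (Q int j' k' i l) (Q C j' k' i l) (Q E j' k' i l) (B j' + B k')
      (Q int j k i l) (Q C j k i l) (Q E j k i l) (B j + B k)"
    unfolding truncates_def
    using truncate_index[OF le(1)] truncate_index[OF le(2)] B[of j'] B[of k'] assms(1) N
    by (intro conjI impI; linarith)
  then show thesis using that[OF le N] N by simp
qed

lemma p_ge_2: "int p \<ge> 2" using p_gt_1 by simp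

lemma invariant_bound_nonneg: "invariant_bound q \<ge> 0" by (simp add: invariant_bound_def)

lemma invariant_quadruple:
  "\<bar>Q int j k i l\<bar> \<le> invariant_bound (int p) \<Longrightarrow>
   invariant (int p) (Q int j k i l) (Q C j k i l) (Q E j k i l) (B j + B k) (B i + B l)"
proof (induction "j + k + i + l" arbitrary: j k i l rule: less_induct)
  case less
  let ?N = "invariant_bound (int p)"
  obtain j' k' i' l' where d:
    "desubst_rel (int p) (Q int j k i l) (Q C j k i l) (Q E j k i l) (B j + B k) (B i + B l)
      (Q int j' k' i' l') (Q C j' k' i' l') (Q E j' k' i' l') (B j' + B k') (B i' + B l')"
    and lt: "j' + k' + i' + l' < j + k + i + l \<or> j + k + i + l = 0"
    by (rule desubst_quadruple)
  show ?case
  proof (cases "j + k + i + l = 0")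
    case True
    have "B 0 = 0" using w_it[of 0 0] by (simp add: B_def)
    then show ?thesis using True invariant_0 by simp
  next
    case False
    then have lt: "j' + k' + i' + l' < j + k + i + l" using lt by blast
    \<comment> \<open>If the desubstituted sum leaves the bound, the pair with the larger total is
      lowered. The total of the positions only decreases, so the induction hypothesis still
      applies.\<close>
    consider "\<bar>Q int j' k' i' l'\<bar> \<le> ?N" | "Q int j' k' i' l' > ?N" | "Q int i' l' j' k' > ?N"
      by linarith
    then show ?thesis
    proof cases
      case 1
      show ?thesis by (rule invariant_step[OF less.hyps[OF lt 1] 1 less.prems p_ge_2 d])
    next
      case 2
      obtain j'' k'' where t: "j'' \<le> j'" "k'' \<le> k'" "Q int j'' k'' i' l' = ?N"
        "truncates ?N (Q C j'' k'' i' l') (Q E j'' k'' i' l') (B j'' + B k'')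
          (Q int j' k' i' l') (Q C j' k' i' l') (Q E j' k' i' l') (B j' + B k')"
        using truncate_quadruple[OF 2 invariant_bound_nonneg] by blast
      have "invariant (int p) ?N (Q C j'' k'' i' l') (Q E j'' k'' i' l') (B j'' + B k'') (B i' + B l')"
        using less.hyps[of j'' k'' i' l'] t lt invariant_bound_nonneg[of "int p"] by simp
      then show ?thesis using invariant_truncate[OF _ t(4) d less.prems p_ge_2] by simp
    next
      case 3
      obtain i'' l'' where t: "i'' \<le> i'" "l'' \<le> l'" "Q int i'' l'' j' k' = ?N"
        "truncates ?N (Q C i'' l'' j' k') (Q E i'' l'' j' k') (B i'' + B l'')
          (Q int i' l' j' k') (Q C i' l' j' k') (Q E i' l' j' k') (B i' + B l')"
        using truncate_quadruple[OF 3 invariant_bound_nonneg] by blast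
      have invariant: "invariant (int p) ?N (Q C i'' l'' j' k') (Q E i'' l'' j' k') (B i'' + B l'') (B j' + B k')"
        using less.hyps[of i'' l'' j' k'] t lt invariant_bound_nonneg[of "int p"] by simp
      have swap: "- Q f a b c e = Q f c e a b" for f a b c e by simp
      have "invariant (int p) (Q int i l j k) (Q C i l j k) (Q E i l j k) (B i + B l) (B j + B k)"
        using invariant_truncate[OF invariant t(4) desubst_rel_swap[OF d, unfolded swap] _ p_ge_2] less.prems
        by (simp add: abs_le_iff)
      from invariant_swap[OF this] show ?thesis unfolding swap .
    qed
  qed
qed

text \<open>Every image contains exactly one letter other than \<open>L\<close>, at its end, so the
  number of such letters before a position is the index of its desubstituted position.\<close>

lemma quadruple_SM_le:
  assumes "Q int j k i l = 0"
  shows "Q C j k i l + Q D j k i l \<le> 3"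
proof -
  let ?N = "invariant_bound (int p)"
  obtain j' k' i' l' where d:
    "desubst_rel (int p) (Q int j k i l) (Q C j k i l) (Q E j k i l) (B j + B k) (B i + B l)
      (Q int j' k' i' l') (Q C j' k' i' l') (Q E j' k' i' l') (B j' + B k') (B i' + B l')"
    and n': "Q C j k i l + Q D j k i l = Q int j' k' i' l'"
    by (rule desubst_quadruple)
  have invariant: "invariant (int p) 0 (Q C j k i l) (Q E j k i l) (B j + B k) (B i + B l)"
    using invariant_quadruple[of j k i l] assms invariant_bound_nonneg[of "int p"] by simp
  consider "\<bar>Q int j' k' i' l'\<bar> \<le> ?N" | "Q int j' k' i' l' > ?N" | "Q int j' k' i' l' < 0"
    using invariant_bound_nonneg[of "int p"] by linarith
  then show ?thesis
  proof cases
    case 1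
    show ?thesis using invariant_parent_le[OF invariant_quadruple[OF 1] invariant _ 1 p_ge_2] d n' assms by simp
  next
    case 2
    obtain j'' k'' where t: "j'' \<le> j'" "k'' \<le> k'" "Q int j'' k'' i' l' = ?N"
      "truncates ?N (Q C j'' k'' i' l') (Q E j'' k'' i' l') (B j'' + B k'')
        (Q int j' k' i' l') (Q C j' k' i' l') (Q E j' k' i' l') (B j' + B k')"
      using truncate_quadruple[OF 2 invariant_bound_nonneg] by blast
    have "invariant (int p) ?N (Q C j'' k'' i' l') (Q E j'' k'' i' l') (B j'' + B k'') (B i' + B l')"
      using invariant_quadruple[of j'' k'' i' l'] t invariant_bound_nonneg[of "int p"] by simp
    \<comment> \<open>Truncation would make the original sum positive, but it is 0.\<close>
    then show ?thesis using invariant_truncate[OF _ t(4) d _ p_ge_2] assms invariant_bound_nonneg[of "int p"] by simp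
  qed (use n' in simp)
qed

section \<open>Balance\<close>

lemma pre_add: "pre (i + n) = pre i @ map w [i..<i + n]"
  using upt_add_eq_append[of 0 i n] by (simp add: pre_def)

lemma occ_factor: "int (occ (map w [i..<i + n]) a) = int (occ (pre (i + n)) a) - int (occ (pre i) a)"
  by (simp add: pre_add)

lemma balancedI:
  assumes "\<And>i j n. int (occ (map w [i..<i + n]) a) - int (occ (map w [j..<j + n]) a) \<le> int c"
  shows "balanced c a w"
  unfolding balanced_def
proof (intro allI impI)
  fix v v' assume "factor v w" "factor v' w" and len: "length v = length v'"
  then obtain i j where v: "v = map w [i..<i + length v]" and v': "v' = map w [j..<j + length v']"
    unfolding factor_def by blast
  have "int (occ v a) - int (occ v' a) \<le> int c" "int (occ v' a) - int (occ v a) \<le> int c"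
    using assms[of i "length v" j, folded v] assms[of j "length v'" i, folded v']
    unfolding len by (simp_all only: len[symmetric] v[symmetric] v'[folded len, symmetric])
  then show "\<bar>int (occ v a) - int (occ v' a)\<bar> \<le> int c" by linarith
qed

lemma quadruple_zero: "\<bar>Q C (i + n) j i (j + n)\<bar> \<le> 2" "\<bar>Q E (i + n) j i (j + n)\<bar> \<le> 2"
proof -
  have B: "0 \<le> B n \<and> B n \<le> 1" for n by (simp add: B_def)
  have "invariant (int p) 0 (Q C (i + n) j i (j + n)) (Q E (i + n) j i (j + n))
      (B (i + n) + B j) (B i + B (j + n))"
    using invariant_quadruple[of "i + n" j i "j + n"] invariant_bound_nonneg[of "int p"] by simp
  from invariant_zero[OF this] show "\<bar>Q C (i + n) j i (j + n)\<bar> \<le> 2" "\<bar>Q E (i + n) j i (j + n)\<bar> \<le> 2"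
    using B[of "i + n"] B[of j] B[of i] B[of "j + n"] by linarith+
qed

lemma balanced_S: "balanced 2 S w"
proof (rule balancedI)
  fix i j n
  show "int (occ (map w [i..<i + n]) S) - int (occ (map w [j..<j + n]) S) \<le> int 2"
    using quadruple_zero(1)[of i n j] unfolding occ_factor C_def by linarith
qed

lemma balanced_L: "balanced 3 L w"
proof (rule balancedI)
  fix i j n
  \<comment> \<open>A surplus of \<open>L\<close> is a deficit of \<open>S\<close> and
    \<open>M\<close> together, hence \<open>i\<close> and \<open>j\<close> change places.\<close>
  have "Q C (j + n) i j (i + n) + Q D (j + n) i j (i + n) \<le> 3"
    by (rule quadruple_SM_le) simp
  moreover have "int (occ (pre m) L) + C m + D m = int m" for m
    using letter_count[of "pre m"] unfolding C_def D_def length_pre by linarith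
  from this[of i] this[of j] this[of "i + n"] this[of "j + n"] calculation
  show "int (occ (map w [i..<i + n]) L) - int (occ (map w [j..<j + n]) L) \<le> int 3"
    unfolding occ_factor by simp
qed

text \<open>Differences of \<open>E\<close> count \<open>M\<close> in windows starting one position
  later, so a factor at position 0 must be found again further right.\<close>

lemma positive_occurrence: "\<exists>i'. map w [i..<i + n] = map w [Suc i'..<Suc i' + n]"
proof (cases i)
  case 0
  obtain a where "a > 0" "\<forall>i<n. w (a + i) = w i" using recurrent by blast
  then have "map w [i..<i + n] = map w [Suc (a - 1)..<Suc (a - 1) + n]"
    using 0 by (intro nth_equalityI) simp_all
  then show ?thesis by blast
next
  case (Suc i')
  then show ?thesis by blast
qed

lemma balanced_M: "balanced 2 M w"
proof (rule balancedI)
  fix i j n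
  obtain i' j' where *: "map w [i..<i + n] = map w [Suc i'..<Suc i' + n]"
    "map w [j..<j + n] = map w [Suc j'..<Suc j' + n]"
    using positive_occurrence[of i n] positive_occurrence[of j n] by blast
  show "int (occ (map w [i..<i + n]) M) - int (occ (map w [j..<j + n]) M) \<le> int 2"
    using quadruple_zero(2)[of i' n j'] unfolding * occ_factor E_def by simp
qed

section \<open>Optimality\<close>

lemma factor_middle: "factor (a @ v @ b) x \<Longrightarrow> factor v x"
proof -
  assume "factor (a @ v @ b) x"
  then obtain i where i: "a @ v @ b = map x [i..<i + length (a @ v @ b)]"
    unfolding factor_def by blast
  have "v = map x [i + length a..<i + length a + length v]"
  proof (rule nth_equalityI)
    fix k assume k: "k < length v"
    then have "v ! k = (a @ v @ b) ! (length a + k)" by (simp add: nth_append)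
    also have "\<dots> = x (i + (length a + k))" by (subst i) (use k in simp)
    finally show "v ! k = map x [i + length a..<i + length a + length v] ! k"
      using k by (simp add: add.assoc)
  qed simp
  then show ?thesis unfolding factor_def by blast
qed

lemma factor_it: "it k = a @ v @ b \<Longrightarrow> factor v w"
proof -
  assume "it k = a @ v @ b"
  moreover have "factor (it k) w"
    using pre_it[of "length (it k)" k] unfolding factor_def pre_def by (intro exI[of _ 0]) simp
  ultimately show ?thesis using factor_middle by metis
qed

lemma factor_phi: "factor v w \<Longrightarrow> factor (phi p v) w"
proof -
  assume "factor v w"
  then obtain i where "v = map w [i..<i + length v]" unfolding factor_def by blast
  then have "pre (i + length v) = pre i @ v" by (simp add: pre_add)
  then have e: "pre (F (i + length v)) = phi p (pre i) @ phi p v @ []"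
    by (simp add: pre_F phi_append)
  have "factor (pre n) w" for n unfolding factor_def pre_def by (intro exI[of _ 0]) simp
  then show ?thesis using factor_middle e by metis
qed

lemma factor_phiI: "factor v w \<Longrightarrow> phi p v = a @ v' @ b \<Longrightarrow> factor v' w"
  using factor_phi factor_middle by metis

lemma not_balancedI:
  assumes "factor v w" "factor v' w" "length v = length v'" "occ v a \<ge> occ v' a + Suc c"
  shows "\<not> balanced c a w"
  using assms unfolding balanced_def by force

lemma replicate_p: "replicate p x = x # replicate (p - 1) x"
  "replicate p x = replicate (p - 1) x @ [x]"
  using p_gt_1 by (cases p; simp add: replicate_append_same)+

lemma replicate_p_2: "replicate p x = x # x # replicate (p - 2) x"
  using p_gt_1 by (cases p; cases "p - 1"; simp)

text \<open>Seed of the explicit factors: the others, except those for \<open>L\<close> with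
  \<open>p = 2\<close>, come from it by applying the morphism and cutting.\<close>

lemma factor_LSL: "factor [L, S, L] w"
proof (rule factor_it[where k = 2])
  show "it 2 = replicate (p - 1) L @ [L, S, L] @ (replicate (p - 1) L @ [S] @ phi p (replicate (p - 2) L @ [S]))"
  proof -
    have "it 2 = phi p (L # L # replicate (p - 2) L @ [S])"
      using replicate_p_2[of L] by (simp add: numeral_2_eq_2 phi_def)
    also have "\<dots> = replicate p L @ [S] @ replicate p L @ [S] @ phi p (replicate (p - 2) L @ [S])"
      by (simp add: phi_Cons phi_append)
    also have "\<dots> = replicate (p - 1) L @ [L, S, L] @ (replicate (p - 1) L @ [S] @ phi p (replicate (p - 2) L @ [S]))"
      using replicate_append_same[of "p - 1" L] by (simp add: replicate_p(2))
    finally show ?thesis .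
  qed
qed

lemma factor_LpSML: "factor (replicate p L @ [S, M] @ replicate p L @ [S]) w"
  by (rule factor_phiI[OF factor_LSL, of "[]" _ "[]"]) (simp add: phi_def)

lemma factor_LSM: "factor [L, S, M] w"
  by (rule factor_middle[of "replicate (p - 1) L" _ "replicate p L @ [S]"])
    (use factor_LpSML in \<open>simp add: replicate_p(2)\<close>)

lemma factor_MLp: "factor (M # replicate p L) w"
  by (rule factor_middle[of "replicate p L @ [S]" _ "[S]"]) (use factor_LpSML in simp)

lemma factor_LSML: "factor ([L, S, M] @ replicate (p - 1) L @ [S]) w"
  by (rule factor_phiI[OF factor_LSM, of "replicate (p - 1) L" _ "[]"])
    (simp add: phi_def replicate_p(2))

lemma factor_SLpSL: "factor ([S] @ replicate p L @ [S, L]) w"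
proof -
  have "factor [M, L, L] w"
    by (rule factor_middle[of "[]" _ "replicate (p - 2) L"])
      (use factor_MLp in \<open>simp add: replicate_p_2\<close>)
  then show ?thesis
    by (rule factor_phiI[of _ "replicate (p - 1) L" _ "replicate (p - 1) L @ [S]"])
      (simp add: phi_def replicate_p(1))
qed

text \<open>The power \<open>(L^p S)^n\<close>.\<close>

definition Lblocks :: "nat \<Rightarrow> letter list" where "Lblocks n = phi p (replicate n L)"

lemma length_Lblocks: "length (Lblocks n) = n * (p + 1)"
  and occ_Lblocks: "occ (Lblocks n) L = n * p" "occ (Lblocks n) S = n" "occ (Lblocks n) M = 0"
  by (induction n) (simp_all add: Lblocks_def phi_Cons)

lemma phi_LSMLS: "phi p ([L, S, M] @ replicate (p - 1) L @ [S]) =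
    replicate p L @ ([S, M] @ replicate (p - 1) L @ [S] @ Lblocks (p - 1) @ [M]) @ []"
  by (simp add: Lblocks_def phi_Cons phi_append)

lemma factor_without_M:
  assumes "q \<le> p"
  shows "factor (replicate (p - 1) L @ [S] @ Lblocks (p - 1) @ replicate q L) w"
proof (rule factor_phiI[OF factor_MLp, of "[]" _ "replicate (p - q) L @ [S]"])
  have "replicate p L = replicate q L @ replicate (p - q) L"
    using assms by (simp flip: replicate_add)
  moreover have "phi p (replicate p L) = Lblocks (p - 1) @ replicate p L @ [S]"
    using arg_cong[OF replicate_p(2)[of L], of "phi p"] by (simp add: Lblocks_def phi_append phi_Cons)
  ultimately show "phi p (M # replicate p L) = [] @ (replicate (p - 1) L @ [S] @ Lblocks (p - 1) @ replicate q L) @ replicate (p - q) L @ [S]"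
    by (simp add: phi_Cons)
qed

text \<open>Two factors of equal length with two \<open>M\<close> and none: the letters
  \<open>M\<close> at both ends are traded for a final \<open>LL\<close>.\<close>

lemma not_balanced_M: "\<not> balanced 1 M w"
proof (rule not_balancedI)
  show "factor ([M] @ replicate (p - 1) L @ [S] @ Lblocks (p - 1) @ [M]) w"
    using factor_phiI[OF factor_LSML, of "replicate p L @ [S]" _ "[]"] phi_LSMLS by simp
  show "factor (replicate (p - 1) L @ [S] @ Lblocks (p - 1) @ replicate 2 L) w"
    using factor_without_M[of 2] p_gt_1 by simp
qed (simp_all add: length_Lblocks occ_Lblocks)

text \<open>The two factors have length \<open>p^2 + 2p + 2\<close> and contain \<open>p + 2\<close>
  and \<open>p\<close> letters \<open>S\<close>.\<close>

lemma not_balanced_S: "\<not> balanced 1 S w"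
proof (rule not_balancedI)
  show "factor ([S] @ Lblocks (p - 1) @ [M] @ replicate (p - 1) L @ [S] @ replicate p L @ [S]) w"
  proof (rule factor_phiI)
    show "factor (replicate p L @ [S, M, L]) w"
      by (rule factor_middle[of "[]" _ "replicate (p - 1) L @ [S]"])
        (use factor_LpSML in \<open>simp add: replicate_p(1)\<close>)
    show "phi p (replicate p L @ [S, M, L]) = replicate p L @
      ([S] @ Lblocks (p - 1) @ [M] @ replicate (p - 1) L @ [S] @ replicate p L @ [S]) @ []"
      by (simp add: replicate_p(1)[of L] Lblocks_def phi_Cons phi_append)
  qed
  show "factor ([M] @ Lblocks p @ [M] @ replicate p L) w"
    by (rule factor_phiI[OF factor_SLpSL, of "[]" _ "[S]"])
      (simp add: Lblocks_def phi_Cons phi_append)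
qed (use p_gt_1 in \<open>simp_all add: length_Lblocks occ_Lblocks algebra_simps\<close>)

text \<open>Around a common middle part, a final \<open>LLL\<close> is compared with
  \<open>SM\<close> in front and \<open>M\<close> behind. \<open>LLL\<close> has to fit into a run
  of \<open>p\<close> letters \<open>L\<close>, hence \<open>p \<ge> 3\<close>.\<close>

lemma not_balanced_L_ge_3:
  assumes "p \<ge> 3"
  shows "\<not> balanced 2 L w"
proof (rule not_balancedI)
  show "factor (replicate (p - 1) L @ [S] @ Lblocks (p - 1) @ replicate 3 L) w"
    using factor_without_M assms by blast
  show "factor ([S, M] @ replicate (p - 1) L @ [S] @ Lblocks (p - 1) @ [M]) w"
    using factor_phiI[OF factor_LSML phi_LSMLS] .
qed (simp_all add: length_Lblocks occ_Lblocks)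

lemma not_balanced_L_2:
  assumes "p = 2"
  shows "\<not> balanced 2 L w"
proof (rule not_balancedI)
  have f: "factor (take m (drop n (it k))) w" for m n k
    by (rule factor_it[of k "take n (it k)" _ "drop m (drop n (it k))"])
      (simp only: append_take_drop_id)
  \<comment> \<open>Explicit windows for \<open>p = 2\<close>, checked by evaluation; the sixth
    iterate has length 182, so the second window is its suffix.\<close>
  show "factor (take 37 (drop 72 (it 6))) w" "factor (take 37 (drop 145 (it 6))) w"
    by (rule f)+
  have it: "it 6 = (phi 2 ^^ 6) [L]" using assms by simp
  have "length (take 37 (drop 72 ((phi 2 ^^ 6) [L]))) = length (take 37 (drop 145 ((phi 2 ^^ 6) [L])))
      \<and> occ (take 37 (drop 145 ((phi 2 ^^ 6) [L]))) L + Suc 2 \<le> occ (take 37 (drop 72 ((phi 2 ^^ 6) [L]))) L"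
    by code_simp
  then show "length (take 37 (drop 72 (it 6))) = length (take 37 (drop 145 (it 6)))"
    "occ (take 37 (drop 145 (it 6))) L + Suc 2 \<le> occ (take 37 (drop 72 (it 6))) L"
    unfolding it by blast+
qed

lemma not_balanced_L: "\<not> balanced 2 L w"
  using not_balanced_L_ge_3 not_balanced_L_2 p_gt_1 by fastforce

end

theorem theorem2p1:
  fixes p :: nat
  assumes "p > 1"
  shows "balanced 3 L (u p) \<and> balanced 2 S (u p) \<and> balanced 2 M (u p)
       \<and> \<not> balanced 2 L (u p) \<and> \<not> balanced 1 S (u p) \<and> \<not> balanced 1 M (u p)"
proof -
  interpret phi_word p by unfold_locales (rule assms)
  show ?thesis
    using balanced_L balanced_S balanced_M not_balanced_L not_balanced_S not_balanced_M by simp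
qed

end
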